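(* For $C,D\ge0$ put $$\widehat f(C,D)=\min\Bigl\{1,\ \inf_{0<\tau<1}\Bigl(\frac{D}{\log(1/\tau)}+\frac{C}{\tau\log2}\Bigr)\Bigr\}\in[0,1].$$ Then $\widehat f(C,D)\to0$ as $C\to0$ (for each fixed $D$), and for every abelian group $G$, every discrete $G$-valued random variable $X$ with countable support $A$, $H(X)\le D$ and $\Delta_{1,2}(X)\le C$ admits a Sidon set $B\subset A$ with $\mathbb P(X\in B)\ge1-\widehat f(C,D)$.
   Context: $H$ is Shannon entropy (natural logarithm). With $X_1,X_2$ independent copies of $X$, let $U_2=\{X_1,X_2\}$ be the unordered pair (multiset) and $S_2=X_1+X_2$; $\Delta_{1,2}(X)=H(U_2)-H(S_2)$. A set $B$ in an abelian group is a Sidon set if $a_1+a_2=b_1+b_2$ with $a_i,b_i\in B$ forces $\{a_1,a_2\}=\{b_1,b_2\}$ as multisets. *)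

theory Defs
  imports "HOL-Probability.Probability" "HOL-Library.Multiset"
begin

text \<open>
  A discrete random variable is represented by its law, a \<^typ>\<open>'a pmf\<close>; its (automatically
  countable) support is \<^const>\<open>set_pmf\<close>.

  Entropy takes extended real values, because a law with infinite support may have infinite
  entropy. The entropy of the library's theory \<open>Information\<close> is built on a Bochner integral and
  would be \<open>0\<close> for such a law.
\<close>

definition shannon_entropy :: "'a pmf \<Rightarrow> ereal" where
  "shannon_entropy p =
     enn2ereal (\<integral>\<^sup>+ x. ennreal (- pmf p x * ln (pmf p x)) \<partial>count_space UNIV)"

definition law_U2 :: "'a pmf \<Rightarrow> 'a multiset pmf" where
  "law_U2 p = map_pmf (\<lambda>(x, y). {#x, y#}) (pair_pmf p p)"

definition law_S2 :: "'a::ab_group_add pmf \<Rightarrow> 'a pmf" where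
  "law_S2 p = map_pmf (\<lambda>(x, y). x + y) (pair_pmf p p)"

text \<open>
  If \<open>p\<close> has finite entropy then so have both laws below. Otherwise the difference may be
  \<open>\<infinity> - \<infinity>\<close>, which is \<open>\<infinity>\<close> for extended reals, so it is not bounded by any real number.
\<close>

definition Delta_1_2 :: "'a::ab_group_add pmf \<Rightarrow> ereal" where
  "Delta_1_2 p = shannon_entropy (law_U2 p) - shannon_entropy (law_S2 p)"

definition sidon_set :: "'a::ab_group_add set \<Rightarrow> bool" where
  "sidon_set B \<longleftrightarrow>
     (\<forall>a\<^sub>1\<in>B. \<forall>a\<^sub>2\<in>B. \<forall>b\<^sub>1\<in>B. \<forall>b\<^sub>2\<in>B.
        a\<^sub>1 + a\<^sub>2 = b\<^sub>1 + b\<^sub>2 \<longrightarrow> {#a\<^sub>1, a\<^sub>2#} = {#b\<^sub>1, b\<^sub>2#})"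

definition f_hat :: "real \<Rightarrow> real \<Rightarrow> real" where
  "f_hat C D = min 1 (INF \<tau>\<in>{0<..<1}. D / ln (1 / \<tau>) + C / (\<tau> * ln 2))"

end

(*
  Call a pair {x, y} a minority pair if it carries at most half of the probability of its sum.
  Since H(U) - H(S) is the expectation of ln (P(S) / P(U)), which is nonnegative and at least ln 2
  at minority pairs, a minority pair is drawn with probability at most C / ln 2. Two different pairs
  with the same sum cannot both be non-minority. Hence one obtains a Sidon set by keeping the atoms
  of mass at least tau (by Markov's inequality the others have total mass at most
  D / ln (1 / tau)) and deleting those that form a minority pair with such an atom: by Fubini,
  tau times the deleted mass is at most the probability of a minority pair. An optimal tau exists
  if C, D > 0 and the infimum is below 1. If C = 0 or D = 0, it need not exist, but then the whole
  support is a Sidon set.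
*)
theory Submission
  imports Defs "HOL-Real_Asymp.Real_Asymp"
begin

section \<open>Markov bounds and the entropy of an image law\<close>

text \<open>The lower bound is required on the support only: where \<open>f\<close> contains
  logarithms of masses, the default values at mass 0 would break it.\<close>

lemma pmf_Markov_inequality:
  fixes f :: "'a \<Rightarrow> real"
  assumes "c > 0" and "K \<ge> 0"
    and int: "(\<integral>\<^sup>+ x. ennreal (f x) \<partial>measure_pmf p) \<le> ennreal K"
    and A: "\<And>x. x \<in> set_pmf p \<Longrightarrow> x \<in> A \<Longrightarrow> c \<le> f x"
  shows "measure_pmf.prob p A \<le> K / c"
proof -
  have "ennreal (c * measure_pmf.prob p A) = (\<integral>\<^sup>+ x. ennreal c * indicator A x \<partial>measure_pmf p)"
    using \<open>c > 0\<close> by (simp add: nn_integral_cmult measure_pmf.emeasure_eq_measure ennreal_mult)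
  also have "\<dots> \<le> (\<integral>\<^sup>+ x. ennreal (f x) \<partial>measure_pmf p)"
    by (intro nn_integral_mono_AE) (auto simp: AE_measure_pmf_iff indicator_def intro!: ennreal_leI A)
  also note int
  finally show ?thesis
    using assms(1,2) by (simp add: field_simps)
qed

lemma shannon_entropy_eq_nn_integral_pmf:
  "shannon_entropy p = enn2ereal (\<integral>\<^sup>+ x. ennreal (- ln (pmf p x)) \<partial>measure_pmf p)"
  unfolding shannon_entropy_def nn_integral_measure_pmf
  by (simp flip: ennreal_mult')

lemma pmf_le_pmf_map: "pmf q u \<le> pmf (map_pmf f q) (f u)"
  by (simp add: pmf_map flip: measure_pmf_single) (rule measure_pmf.finite_measure_mono; simp)

lemma pmf_add_le_pmf_map:
  assumes "u \<noteq> v" and "f u = f v"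
  shows "pmf q u + pmf q v \<le> pmf (map_pmf f q) (f u)"
proof -
  have "pmf q u + pmf q v = measure_pmf.prob q {u, v}"
    using assms(1) by (simp add: measure_measure_pmf_finite)
  also have "\<dots> \<le> measure_pmf.prob q (f -` {f u})"
    using assms(2) by (intro measure_pmf.finite_measure_mono) auto
  finally show ?thesis by (simp add: pmf_map)
qed

text \<open>Chain rule; the last integral is the conditional entropy given the value of
  \<open>f\<close>. The logarithm splits pointwise into two nonnegative terms, as
  \<open>pmf q u \<le> pmf (map_pmf f q) (f u) \<le> 1\<close>, so infinite entropies are covered
  too.\<close>

lemma shannon_entropy_map_pmf:
  "shannon_entropy q = shannon_entropy (map_pmf f q) +
     enn2ereal (\<integral>\<^sup>+ u. ennreal (ln (pmf (map_pmf f q) (f u) / pmf q u)) \<partial>measure_pmf q)"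
proof -
  let ?P = "\<lambda>u. pmf (map_pmf f q) (f u)"
  have "ennreal (- ln (pmf q u)) = ennreal (- ln (?P u)) + ennreal (ln (?P u / pmf q u))"
    if "u \<in> set_pmf q" for u
  proof -
    have pos: "0 < pmf q u" using that by (simp add: pmf_positive)
    moreover have "pmf q u \<le> ?P u" by (rule pmf_le_pmf_map)
    ultimately show ?thesis
      by (subst ennreal_plus[symmetric]) (auto simp: ln_div pmf_le_1)
  qed
  then have "(\<integral>\<^sup>+ u. ennreal (- ln (pmf q u)) \<partial>measure_pmf q)
      = (\<integral>\<^sup>+ u. ennreal (- ln (?P u)) + ennreal (ln (?P u / pmf q u)) \<partial>measure_pmf q)"
    by (intro nn_integral_cong_AE) (simp add: AE_measure_pmf_iff)
  also have "\<dots> = (\<integral>\<^sup>+ u. ennreal (- ln (?P u)) \<partial>measure_pmf q)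
      + (\<integral>\<^sup>+ u. ennreal (ln (?P u / pmf q u)) \<partial>measure_pmf q)"
    by (rule nn_integral_add) simp_all
  finally show ?thesis
    by (simp add: shannon_entropy_eq_nn_integral_pmf plus_ennreal.rep_eq)
qed

text \<open>Exactly half counts as minority: on the support the ratio of masses is then still 2, and
  two atoms of exactly half with the same image cannot both stay outside the set.\<close>

definition minority_atoms :: "('a \<Rightarrow> 'b) \<Rightarrow> 'a pmf \<Rightarrow> 'a set" where
  "minority_atoms f q = {u. 2 * pmf q u \<le> pmf (map_pmf f q) (f u)}"

lemma prob_minority_atoms_le:
  assumes "shannon_entropy q - shannon_entropy (map_pmf f q) \<le> ereal C" and "C \<ge> 0"
  shows "measure_pmf.prob q (minority_atoms f q) \<le> C / ln 2"
proof -
  let ?g = "\<lambda>u. ln (pmf (map_pmf f q) (f u) / pmf q u)"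
  define K where "K = (\<integral>\<^sup>+ u. ennreal (?g u) \<partial>measure_pmf q)"
  have nonneg: "shannon_entropy (map_pmf f q) \<ge> 0"
    by (simp add: shannon_entropy_def)
  \<comment> \<open>If the image had infinite entropy, so would \<open>q\<close>, and
    \<open>\<infinity> - \<infinity> = \<infinity>\<close> would exceed \<open>C\<close>. A finite
    entropy cancels.\<close>
  have "enn2ereal K \<le> ereal C"
    using assms(1) shannon_entropy_map_pmf[of q f, folded K_def] nonneg
    by (cases "shannon_entropy (map_pmf f q)"; cases "enn2ereal K") auto
  then have "K \<le> ennreal C"
    using assms(2) by (simp add: less_eq_ennreal.rep_eq)
  then show ?thesis
    unfolding K_def
  proof (rule pmf_Markov_inequality[rotated 2])
    fix u assume "u \<in> set_pmf q" "u \<in> minority_atoms f q"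
    then have "0 < pmf q u" "2 * pmf q u \<le> pmf (map_pmf f q) (f u)"
      by (simp_all add: pmf_positive minority_atoms_def)
    then show "ln 2 \<le> ?g u"
      by (intro ln_mono) (auto simp: field_simps)
  qed (use assms(2) in simp_all)
qed

text \<open>Markov's inequality for \<open>?h\<close>, whose mean is the product probability by
  Fubini. A single related atom of mass at least \<tau> already gives
  \<open>?h x \<ge> \<tau>\<close>.\<close>

lemma prob_related_to_heavy_atom_le:
  assumes "\<tau> > 0"
  shows "measure_pmf.prob p {x. \<exists>y. pmf q y \<ge> \<tau> \<and> R x y}
    \<le> measure_pmf.prob (pair_pmf p q) {(x, y). R x y} / \<tau>"
proof -
  let ?h = "\<lambda>x. measure_pmf.prob q {y. R x y}"
  have "(\<integral>\<^sup>+ x. ennreal (?h x) \<partial>measure_pmf p)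
      = (\<integral>\<^sup>+ x. (\<integral>\<^sup>+ y. indicator {(x, y). R x y} (x, y) \<partial>measure_pmf q) \<partial>measure_pmf p)"
    by (intro nn_integral_cong)
      (simp add: nn_integral_indicator[symmetric] indicator_def
        flip: measure_pmf.emeasure_eq_measure del: nn_integral_indicator)
  also have "\<dots> = ennreal (measure_pmf.prob (pair_pmf p q) {(x, y). R x y})"
    by (simp flip: nn_integral_pair_pmf' add: measure_pmf.emeasure_eq_measure)
  finally have "(\<integral>\<^sup>+ x. ennreal (?h x) \<partial>measure_pmf p)
      \<le> ennreal (measure_pmf.prob (pair_pmf p q) {(x, y). R x y})"
    by simp
  then show ?thesis
  proof (rule pmf_Markov_inequality[rotated 2])
    fix x assume "x \<in> {x. \<exists>y. pmf q y \<ge> \<tau> \<and> R x y}"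
    then obtain y where y: "pmf q y \<ge> \<tau>" "R x y" by auto
    note y(1)
    also have "pmf q y \<le> ?h x"
      using y(2) by (simp flip: measure_pmf_single) (rule measure_pmf.finite_measure_mono; simp)
    finally show "\<tau> \<le> ?h x" .
  qed (use assms in simp_all)
qed

lemma prob_light_atoms_le:
  assumes "shannon_entropy p \<le> ereal D" and "D \<ge> 0" and "0 < \<tau>" and "\<tau> < 1"
  shows "measure_pmf.prob p {x. pmf p x < \<tau>} \<le> D / ln (1 / \<tau>)"
proof (rule pmf_Markov_inequality)
  show "(\<integral>\<^sup>+ x. ennreal (- ln (pmf p x)) \<partial>measure_pmf p) \<le> ennreal D"
    using assms(1,2) by (simp add: shannon_entropy_eq_nn_integral_pmf less_eq_ennreal.rep_eq)
next
  fix x assume "x \<in> set_pmf p" "x \<in> {x. pmf p x < \<tau>}"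
  then have "0 < pmf p x" "pmf p x < \<tau>" by (simp_all add: pmf_positive)
  then show "ln (1 / \<tau>) \<le> - ln (pmf p x)"
    using assms(3) by (simp add: ln_div)
qed (use assms in simp_all)

section \<open>Sidon sets from non-minority pairs\<close>

lemma law_S2_eq_map_law_U2: "law_S2 p = map_pmf sum_mset (law_U2 p)"
  by (simp add: law_S2_def law_U2_def pmf.map_comp o_def case_prod_unfold)

lemma sidon_setI_minority:
  assumes "\<And>x y. x \<in> B \<Longrightarrow> y \<in> B \<Longrightarrow> {#x, y#} \<notin> minority_atoms sum_mset q"
  shows "sidon_set B"
  unfolding sidon_set_def
proof (intro ballI impI, rule ccontr)
  fix a b c d assume in_B: "a \<in> B" "b \<in> B" "c \<in> B" "d \<in> B"
    and eq: "a + b = c + d" and neq: "{#a, b#} \<noteq> {#c, d#}"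
  have "pmf q {#a, b#} + pmf q {#c, d#} \<le> pmf (map_pmf sum_mset q) (a + b)"
    using pmf_add_le_pmf_map[OF neq, of sum_mset q] eq by simp
  with assms[of a b] assms[of c d] in_B eq show False
    by (simp add: minority_atoms_def)
qed

text \<open>Pulls the bound back from multisets to ordered pairs, whose product law is what Fubini
  needs.\<close>

lemma prob_minority_pairs_le:
  assumes "Delta_1_2 p \<le> ereal C" and "C \<ge> 0"
  shows "measure_pmf.prob (pair_pmf p p) {(x, y). {#x, y#} \<in> minority_atoms sum_mset (law_U2 p)}
    \<le> C / ln 2"
proof -
  have "(\<lambda>(x, y). {#x, y#}) -` minority_atoms sum_mset (law_U2 p)
      = {(x, y). {#x, y#} \<in> minority_atoms sum_mset (law_U2 p)}"
    by auto
  then show ?thesis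
    using prob_minority_atoms_le[of "law_U2 p" sum_mset C] assms
    by (simp add: Delta_1_2_def law_S2_eq_map_law_U2)
      (simp add: law_U2_def)
qed

lemma exists_sidon_set:
  assumes H: "shannon_entropy p \<le> ereal D" "D \<ge> 0"
    and Delta: "Delta_1_2 p \<le> ereal C" "C \<ge> 0"
    and \<tau>: "0 < \<tau>" "\<tau> < 1"
  shows "\<exists>B\<subseteq>set_pmf p. sidon_set B \<and>
    measure_pmf.prob p B \<ge> 1 - (D / ln (1 / \<tau>) + C / (\<tau> * ln 2))"
proof -
  let ?bad = "\<lambda>x y. {#x, y#} \<in> minority_atoms sum_mset (law_U2 p)"
  define L where "L = {x. pmf p x < \<tau>}"
  define E where "E = {x. \<exists>y. pmf p y \<ge> \<tau> \<and> ?bad x y}"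
  \<comment> \<open>Points outside the support have mass 0 and hence lie in
    \<open>L\<close>.\<close>
  define B where "B = UNIV - (L \<union> E)"
  have "B \<subseteq> set_pmf p"
    using \<tau> by (auto simp: B_def L_def set_pmf_iff)
  \<comment> \<open>Every \<open>y\<close> in \<open>B\<close> is heavy, so a minority pair of
    \<open>x\<close> and \<open>y\<close> would put \<open>x\<close> into \<open>E\<close>.\<close>
  moreover have "sidon_set B"
    by (rule sidon_setI_minority[of _ "law_U2 p"]) (auto simp: B_def L_def E_def not_less)
  moreover have "measure_pmf.prob p B \<ge> 1 - (D / ln (1 / \<tau>) + C / (\<tau> * ln 2))"
  proof -
    have "measure_pmf.prob p E \<le> (C / ln 2) / \<tau>"
      unfolding E_def using prob_minority_pairs_le[OF Delta] \<tau>
      by (intro order.trans[OF prob_related_to_heavy_atom_le] divide_right_mono) auto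
    moreover have "measure_pmf.prob p L \<le> D / ln (1 / \<tau>)"
      unfolding L_def using H \<tau> by (rule prob_light_atoms_le)
    moreover have "measure_pmf.prob p B = 1 - measure_pmf.prob p (L \<union> E)"
      unfolding B_def using measure_pmf.prob_compl[of "L \<union> E" p] by simp
    moreover have "measure_pmf.prob p (L \<union> E) \<le> measure_pmf.prob p L + measure_pmf.prob p E"
      by (rule measure_Un_le) auto
    ultimately show ?thesis by (simp add: mult.commute)
  qed
  ultimately show ?thesis by blast
qed

text \<open>The minority pairs form a null set, which a discrete law can only have off its
  support.\<close>

lemma sidon_set_set_pmf_if_Delta_zero:
  assumes "Delta_1_2 p \<le> ereal 0"
  shows "sidon_set (set_pmf p)"
proof (rule sidon_setI_minority[of _ "law_U2 p"])
  let ?A = "{(x, y). {#x, y#} \<in> minority_atoms sum_mset (law_U2 p)}"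
  fix x y assume "x \<in> set_pmf p" "y \<in> set_pmf p"
  moreover have "measure_pmf.prob (pair_pmf p p) ?A = 0"
    using prob_minority_pairs_le[OF assms] by (simp add: measure_le_0_iff)
  ultimately show "{#x, y#} \<notin> minority_atoms sum_mset (law_U2 p)"
    by (auto simp: measure_pmf_zero_iff)
qed

lemma sidon_set_set_pmf_if_entropy_zero:
  fixes p :: "'g::ab_group_add pmf"
  assumes "shannon_entropy p \<le> ereal 0"
  shows "sidon_set (set_pmf p)"
proof -
  have one: "pmf p x = 1" if "x \<in> set_pmf p" for x
  proof -
    have "measure_pmf.prob p {x. pmf p x < \<tau>} = 0" if "0 < \<tau>" "\<tau> < 1" for \<tau>
      using prob_light_atoms_le[OF assms _ that] by (simp add: measure_le_0_iff)
    then have light: "\<not> pmf p x < \<tau>" if "0 < \<tau>" "\<tau> < 1" for \<tau>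
      using \<open>x \<in> set_pmf p\<close> that by (auto simp: measure_pmf_zero_iff)
    \<comment> \<open>If the mass of \<open>x\<close> were below 1, the midpoint between it and 1
      would be a threshold below which \<open>x\<close> is light.\<close>
    show ?thesis
      using light[of "(1 + pmf p x) / 2"] pmf_le_1[of p x] pmf_positive[OF that]
      by (cases "pmf p x < 1") auto
  qed
  \<comment> \<open>Under a constant map, two distinct atoms of mass 1 would give the image point
    mass at least 2.\<close>
  have "x = y" if "x \<in> set_pmf p" "y \<in> set_pmf p" for x y
    using pmf_add_le_pmf_map[of x y "\<lambda>_. ()" p] one that pmf_le_1[of "map_pmf (\<lambda>_. ()) p" "()"]
    by force
  then show ?thesis
    unfolding sidon_set_def by metis
qed

section \<open>The function \<open>f_hat\<close> and its infimum\<close>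

lemma bdd_below_f_hat:
  fixes C D :: real
  assumes "C \<ge> 0" and "D \<ge> 0"
  shows "bdd_below ((\<lambda>\<tau>. D / ln (1 / \<tau>) + C / (\<tau> * ln 2)) ` {0<..<1})"
  using assms by (intro bdd_belowI[of _ 0]) auto

lemma f_hat_nonneg:
  assumes "C \<ge> 0" and "D \<ge> 0"
  shows "f_hat C D \<ge> 0"
proof -
  have "0 \<le> (INF \<tau>\<in>{0<..<1::real}. D / ln (1 / \<tau>) + C / (\<tau> * ln 2))"
    using assms by (intro cINF_greatest) auto
  then show ?thesis by (simp add: f_hat_def)
qed

lemma f_hat_le:
  assumes "C \<ge> 0" and "D \<ge> 0" and "0 < \<tau>" and "\<tau> < 1"
  shows "f_hat C D \<le> D / ln (1 / \<tau>) + C / (\<tau> * ln 2)"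
  unfolding f_hat_def
  using assms cINF_lower[OF bdd_below_f_hat[OF assms(1,2)], of \<tau>] by (auto simp: min.coboundedI2)

lemma f_hat_tendsto_0:
  assumes "D \<ge> 0"
  shows "((\<lambda>c. f_hat c D) \<longlongrightarrow> 0) (at_right 0)"
proof (rule tendsto_sandwich)
  show "eventually (\<lambda>c. 0 \<le> f_hat c D) (at_right 0)"
    using f_hat_nonneg assms by (auto simp: eventually_at_right_field intro: exI[of _ 1])
  \<comment> \<open>The choice \<tau> = \<open>sqrt c\<close> tends to 0, which kills the first
    term, but slower than \<open>c\<close>, which kills the second.\<close>
  have "f_hat c D \<le> D / ln (1 / sqrt c) + c / (sqrt c * ln 2)" if "0 < c" "c < 1" for c
    using that assms by (intro f_hat_le) auto
  then show "eventually (\<lambda>c. f_hat c D \<le> D / ln (1 / sqrt c) + c / (sqrt c * ln 2)) (at_right 0)"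
    by (auto simp: eventually_at_right_field intro: exI[of _ 1])
  show "((\<lambda>c. D / ln (1 / sqrt c) + c / (sqrt c * ln 2)) \<longlongrightarrow> 0) (at_right 0)"
    by real_asymp
qed simp

text \<open>Both terms of \<open>g\<close> are positive, so \<open>g \<tau> < 1\<close> bounds each
  by 1 and confines \<tau> to the compact interval \<open>{a..b}\<close> inside the open unit
  interval, where the continuous \<open>g\<close> has a minimum.\<close>

lemma f_hat_attained:
  assumes "C > 0" and "D > 0" and "f_hat C D < 1"
  obtains \<tau> where "0 < \<tau>" "\<tau> < 1" "D / ln (1 / \<tau>) + C / (\<tau> * ln 2) = f_hat C D"
proof -
  define g where "g = (\<lambda>\<tau>::real. D / ln (1 / \<tau>) + C / (\<tau> * ln 2))"
  define a where "a = C / ln 2"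
  define b where "b = exp (- D)"
  have f_hat: "f_hat C D = (INF \<tau>\<in>{0<..<1}. g \<tau>)"
    using assms(3) by (simp add: f_hat_def g_def)
  have ab: "a > 0" "b < 1" using assms by (simp_all add: a_def b_def)
  have small: "\<tau> \<in> {a..b}" if "0 < \<tau>" "\<tau> < 1" "g \<tau> < 1" for \<tau>
  proof -
    have pos: "ln (1 / \<tau>) > 0" "D / ln (1 / \<tau>) > 0" "C / (\<tau> * ln 2) > 0"
      using that assms by auto
    then have "D / ln (1 / \<tau>) < 1" "C / (\<tau> * ln 2) < 1"
      using that(3) unfolding g_def by linarith+
    then have "D < ln (1 / \<tau>)" "C < \<tau> * ln 2"
      using pos(1) that(1) pos_divide_less_eq[of "ln (1 / \<tau>)" D 1]
        pos_divide_less_eq[of "\<tau> * ln 2" C 1] by auto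
    then have "ln \<tau> \<le> - D" "a \<le> \<tau>"
      using that(1) by (auto simp: ln_div a_def divide_le_eq)
    then show ?thesis
      using that(1) exp_le_cancel_iff[of "ln \<tau>" "- D"] by (simp add: b_def)
  qed
  obtain t where t: "0 < t" "t < 1" "g t < 1"
    using assms(3) cINF_less_iff[of "{0<..<1}" g 1] bdd_below_f_hat[of C D] assms(1,2)
    unfolding f_hat by (auto simp: g_def)
  have "continuous_on {a..b} g"
    unfolding g_def using ab by (intro continuous_intros) auto
  then obtain \<tau> where \<tau>: "\<tau> \<in> {a..b}" "\<And>s. s \<in> {a..b} \<Longrightarrow> g \<tau> \<le> g s"
    using continuous_attains_inf[of "{a..b}" g] small[OF t] by auto
  have \<tau>01: "0 < \<tau>" "\<tau> < 1" using \<tau>(1) ab by auto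
  \<comment> \<open>Where \<open>g s \<ge> 1\<close>, the point \<open>t\<close> serves for
    comparison: \<open>g \<tau> \<le> g t < 1\<close>.\<close>
  have "g \<tau> \<le> g s" if "s \<in> {0<..<1}" for s
    using small[of s] small[OF t] \<tau>(2) t that by (cases "g s < 1") force+
  then have "g \<tau> \<le> f_hat C D"
    unfolding f_hat by (intro cINF_greatest) auto
  moreover have "f_hat C D \<le> g \<tau>"
    unfolding g_def using assms \<tau>01 by (intro f_hat_le) auto
  ultimately show ?thesis
    using that[of \<tau>] \<tau>01 by (simp add: g_def)
qed

theorem corollary4p3:
  fixes C D :: real
  assumes "C \<ge> 0" and "D \<ge> 0"
  shows "f_hat C D \<in> {0..1} \<and>
    ((\<lambda>c. f_hat c D) \<longlongrightarrow> 0) (at_right 0) \<and>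
    (\<forall>X :: 'g::ab_group_add pmf.
       shannon_entropy X \<le> ereal D \<and> Delta_1_2 X \<le> ereal C \<longrightarrow>
       (\<exists>B \<subseteq> set_pmf X. sidon_set B \<and> measure_pmf.prob X B \<ge> 1 - f_hat C D))"
proof (intro conjI allI impI)
  show "f_hat C D \<in> {0..1}"
    using f_hat_nonneg[OF assms] by (simp add: f_hat_def)
  show "((\<lambda>c. f_hat c D) \<longlongrightarrow> 0) (at_right 0)"
    using assms(2) by (rule f_hat_tendsto_0)
next
  fix X :: "'g pmf"
  assume X: "shannon_entropy X \<le> ereal D \<and> Delta_1_2 X \<le> ereal C"
  \<comment> \<open>If just one of \<open>C\<close> and \<open>D\<close> is 0, the infimum is only
    approached, as \<tau> tends to 0 or 1 respectively. If \<open>f_hat C D \<ge> 1\<close>, the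
    empty set suffices.\<close>
  consider "C = 0 \<or> D = 0" | "f_hat C D \<ge> 1" | "C > 0" "D > 0" "f_hat C D < 1"
    using assms by linarith
  then show "\<exists>B \<subseteq> set_pmf X. sidon_set B \<and> measure_pmf.prob X B \<ge> 1 - f_hat C D"
  proof cases
    case 1
    then have "sidon_set (set_pmf X)"
      using X sidon_set_set_pmf_if_Delta_zero sidon_set_set_pmf_if_entropy_zero by blast
    then show ?thesis
      using f_hat_nonneg[OF assms] measure_pmf.prob_eq_1[of "set_pmf X" X]
      by (intro exI[of _ "set_pmf X"]) (simp add: AE_measure_pmf)
  next
    case 2
    then show ?thesis by (intro exI[of _ "{}"]) (simp add: sidon_set_def)
  next
    case 3
    then obtain \<tau> where \<tau>: "0 < \<tau>" "\<tau> < 1" "D / ln (1 / \<tau>) + C / (\<tau> * ln 2) = f_hat C D"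
      by (rule f_hat_attained)
    then show ?thesis
      using exists_sidon_set[of X D C \<tau>] X assms by simp
  qed
qed

end
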